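(* Let $\{d_n\}_{n=1}^{\infty}\in \ell_2\setminus \ell_1$ be a sequence of positive numbers such that, for some real constant $C$, $$\frac{d_{n+1}}{d_n}=1+Cd_n+O(d_n^2).$$ Let $r_0=1$, $r_n=\sqrt{d_n+d_{n+1}}$ for $n\ge 1$, and $$F(n)=\frac{1}{d_{n}}\Bigl(\frac{r_n}{r_{n-1}}-1\Bigr)+\frac{1}{d_{n+1}}\Bigl(\frac{r_n}{r_{n+1}}-1\Bigr)\qquad(n\in\mathbb{N}).$$ Then $F(n)=O(d_n)$.
   Context: $\mathbb{N}=\{1,2,\dots\}$. $\ell_1$ and $\ell_2$ are the spaces of absolutely summable and square-summable sequences. For a positive sequence $(b_n)$, the notation $a_n=O(b_n)$ means that there is a constant $K>0$ with $|a_n|\le K b_n$ for all sufficiently large $n$, and $a_n=c_n+O(b_n)$ means $a_n-c_n=O(b_n)$. *)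

theory Defs
  imports "HOL-Analysis.Infinite_Sum" "HOL-Library.Landau_Symbols"
begin

text \<open>Sequences indexed by the positive integers are functions on \<^typ>\<open>nat\<close>; the value \<open>d 0\<close> is junk
  and is not used by the definitions below at any index \<open>n \<ge> 1\<close>.\<close>

definition r :: "(nat \<Rightarrow> real) \<Rightarrow> nat \<Rightarrow> real" where
  "r d n = (if n = 0 then 1 else sqrt (d n + d (n + 1)))"

definition F :: "(nat \<Rightarrow> real) \<Rightarrow> nat \<Rightarrow> real" where
  "F d n = 1 / d n * (r d n / r d (n - 1) - 1) + 1 / d (n + 1) * (r d n / r d (n + 1) - 1)"

end

theory Submission
  imports Defs
begin

text \<open>
  Write \<open>q n = d (n + 1) / d n\<close> for the ratios of consecutive terms and \<open>a n = r (n + 1) / r n\<close>.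
  Since \<open>d n \<longlonglongrightarrow> 0\<close>, the relation \<open>f n = c + O(d n)\<close> is preserved by sums, products and quotients
  with a nonzero limit in the denominator, and, because \<open>q n \<longlonglongrightarrow> 1\<close>, also by an index shift.
  So it is enough to write \<open>F\<close> as a rational expression in quantities with a known expansion.

  The hypothesis says that \<open>(q n - 1) / d n = C + O(d n)\<close>. The identity
  \<open>(a n)\<^sup>2 = q n * (1 + q (n + 1)) / (1 + q n)\<close> gives
  \<open>((a n)\<^sup>2 - 1) / d n = ((q n - 1) / d n * q (n + 1) + (q (n + 1) - 1) / d (n + 1) * q n) / (1 + q n)\<close>,
  which is \<open>C + O(d n)\<close>. As \<open>a n - 1 = ((a n)\<^sup>2 - 1) / (a n + 1)\<close>, the quantity
  \<open>G n = (a n - 1) / d (n + 1)\<close> is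
  \<open>C / 2 + O(d n)\<close>. Finally \<open>F (n + 1) = G n - G (n + 1) / a (n + 1)\<close>, where the two constants
  \<open>C / 2\<close> cancel.
\<close>

section \<open>Arithmetic of expansions with remainder in a null sequence\<close>

lemma bigo_const_imp_tendsto:
  fixes f g :: "'a \<Rightarrow> real"
  assumes "(\<lambda>x. f x - c) \<in> O[A](g)" and "(g \<longlongrightarrow> 0) A"
  shows "(f \<longlongrightarrow> c) A"
proof -
  obtain K where "K > 0" and K: "eventually (\<lambda>x. norm (f x - c) \<le> K * norm (g x)) A"
    using landau_o.bigE[OF assms(1)] by blast
  have "((\<lambda>x. f x - c) \<longlongrightarrow> 0) A"
    by (rule tendsto_0_le[OF assms(2), where K = K]) (use K in \<open>simp add: mult.commute\<close>)
  then show ?thesis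
    using LIM_zero_cancel by blast
qed

lemma bigo_eventually_eq:
  fixes f f' g :: "'a \<Rightarrow> real"
  assumes "f \<in> O[A](g)" and "eventually (\<lambda>x. f x = f' x) A"
  shows "f' \<in> O[A](g)"
  using assms landau_o.big.in_cong by blast

lemma bigo_const_add:
  fixes f f' g :: "'a \<Rightarrow> real"
  assumes "(\<lambda>x. f x - c) \<in> O[A](g)" and "(\<lambda>x. f' x - c') \<in> O[A](g)"
  shows "(\<lambda>x. (f x + f' x) - (c + c')) \<in> O[A](g)"
  using sum_in_bigo(1)[OF assms] by (simp add: algebra_simps)

lemma bigo_const_diff:
  fixes f f' g :: "'a \<Rightarrow> real"
  assumes "(\<lambda>x. f x - c) \<in> O[A](g)" and "(\<lambda>x. f' x - c') \<in> O[A](g)"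
  shows "(\<lambda>x. (f x - f' x) - (c - c')) \<in> O[A](g)"
  using sum_in_bigo(2)[OF assms] by (simp add: algebra_simps)

lemma tendsto_mult_bigo:
  fixes f h g :: "'a \<Rightarrow> real"
  assumes "(h \<longlongrightarrow> l) A" and "f \<in> O[A](g)"
  shows "(\<lambda>x. h x * f x) \<in> O[A](g)"
proof -
  have "h \<in> O[A](\<lambda>_. 1)"
    using assms(1) by (intro bigoI_tendsto[where c = l]) auto
  then show ?thesis
    using landau_o.big.mult[OF _ assms(2)] by fastforce
qed

lemma bigo_const_mult:
  fixes f f' g :: "'a \<Rightarrow> real"
  assumes "(g \<longlongrightarrow> 0) A"
    and "(\<lambda>x. f x - c) \<in> O[A](g)" and "(\<lambda>x. f' x - c') \<in> O[A](g)"
  shows "(\<lambda>x. f x * f' x - c * c') \<in> O[A](g)"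
proof -
  have "(\<lambda>x. f x * (f' x - c')) \<in> O[A](g)"
    by (rule tendsto_mult_bigo[OF bigo_const_imp_tendsto[OF assms(2,1)] assms(3)])
  moreover have "(\<lambda>x. c' * (f x - c)) \<in> O[A](g)"
    by (rule tendsto_mult_bigo[OF tendsto_const assms(2)])
  ultimately have "(\<lambda>x. f x * (f' x - c') + c' * (f x - c)) \<in> O[A](g)"
    by (rule sum_in_bigo)
  then show ?thesis by (simp add: algebra_simps)
qed

lemma bigo_const_inverse:
  fixes f g :: "'a \<Rightarrow> real"
  assumes "(g \<longlongrightarrow> 0) A" and "(\<lambda>x. f x - c) \<in> O[A](g)" and "c \<noteq> 0"
  shows "(\<lambda>x. inverse (f x) - inverse c) \<in> O[A](g)"
proof -
  have lim: "(f \<longlongrightarrow> c) A"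
    by (rule bigo_const_imp_tendsto[OF assms(2,1)])
  have "((\<lambda>x. - (inverse (f x) * inverse c)) \<longlongrightarrow> - (inverse c * inverse c)) A"
    by (intro tendsto_intros lim assms(3))
  then have "(\<lambda>x. - (inverse (f x) * inverse c) * (f x - c)) \<in> O[A](g)"
    by (rule tendsto_mult_bigo[OF _ assms(2)])
  moreover have "eventually (\<lambda>x. - (inverse (f x) * inverse c) * (f x - c)
      = inverse (f x) - inverse c) A"
    using tendsto_imp_eventually_ne[OF lim assms(3)]
    by eventually_elim (use assms(3) in \<open>simp add: field_simps\<close>)
  ultimately show ?thesis
    by (rule bigo_eventually_eq)
qed

lemma bigo_const_divide:
  fixes f f' g :: "'a \<Rightarrow> real"
  assumes "(g \<longlongrightarrow> 0) A"
    and "(\<lambda>x. f x - c) \<in> O[A](g)" and "(\<lambda>x. f' x - c') \<in> O[A](g)" and "c' \<noteq> 0"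
  shows "(\<lambda>x. f x / f' x - c / c') \<in> O[A](g)"
  using bigo_const_mult[OF assms(1,2) bigo_const_inverse[OF assms(1,3,4)]]
  by (simp add: divide_inverse)

lemma bigo_Suc_cancel:
  fixes f g :: "nat \<Rightarrow> real"
  assumes "(\<lambda>n. f (Suc n)) \<in> O(\<lambda>n. g (Suc n))"
  shows "f \<in> O(g)"
proof -
  obtain K where "eventually (\<lambda>n. norm (f (Suc n)) \<le> K * norm (g (Suc n))) sequentially"
    using landau_o.bigE[OF assms] by blast
  then show ?thesis
    using eventually_sequentially_Suc[of "\<lambda>n. norm (f n) \<le> K * norm (g n)"]
    by (intro bigoI[of _ K]) auto
qed

text \<open>This removes the square root from \<open>r\<close>: the factor \<open>a + 1\<close> of \<open>a\<^sup>2 - 1\<close> is at least \<open>1\<close>, so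
  \<open>\<bar>a - 1\<bar> \<le> \<bar>a\<^sup>2 - 1\<bar>\<close>. It gives \<open>a \<longlonglongrightarrow> 1\<close> at the right rate, after which the exact constant in
  \<open>a - 1\<close> follows by dividing \<open>a\<^sup>2 - 1\<close> by \<open>a + 1\<close>.\<close>

lemma bigo_square_minus_one:
  fixes a g :: "'a \<Rightarrow> real"
  assumes "eventually (\<lambda>x. a x \<ge> 0) A" and "(\<lambda>x. (a x)\<^sup>2 - 1) \<in> O[A](g)"
  shows "(\<lambda>x. a x - 1) \<in> O[A](g)"
proof -
  have "\<bar>a x - 1\<bar> \<le> \<bar>(a x)\<^sup>2 - 1\<bar>" if "a x \<ge> 0" for x
  proof -
    have "\<bar>(a x)\<^sup>2 - 1\<bar> = (a x + 1) * \<bar>a x - 1\<bar>"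
      using that by (simp add: power2_eq_square square_diff_one_factored abs_mult)
    then show ?thesis
      using that mult_right_mono[of 1 "a x + 1" "\<bar>a x - 1\<bar>"] by simp
  qed
  then have "(\<lambda>x. a x - 1) \<in> O[A](\<lambda>x. (a x)\<^sup>2 - 1)"
    using assms(1) by (intro landau_o.big_mono) (auto elim: eventually_mono)
  then show ?thesis
    using assms(2) landau_o.big_trans by blast
qed

section \<open>Square-summable sequences tend to zero\<close>

lemma square_summable_on_imp_tendsto_0:
  fixes d :: "nat \<Rightarrow> real"
  assumes "(\<lambda>n. (d n)\<^sup>2) summable_on {1..}"
  shows "d \<longlonglongrightarrow> 0"
proof -
  have "range Suc = {1..}"
    by (auto simp: image_iff Suc_le_eq gr0_conv_Suc)
  then have "(\<lambda>n. (d (Suc n))\<^sup>2) summable_on UNIV"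
    using assms summable_on_reindex[of Suc UNIV "\<lambda>n. (d n)\<^sup>2"] by (simp add: o_def)
  then have "(\<lambda>n. (d (Suc n))\<^sup>2) \<longlonglongrightarrow> 0"
    using summable_on_imp_summable summable_LIMSEQ_zero by blast
  then have "(\<lambda>n. d (Suc n)) \<longlonglongrightarrow> 0"
    using tendsto_real_sqrt[of "\<lambda>n. (d (Suc n))\<^sup>2" 0] by (simp add: tendsto_rabs_zero_iff)
  then show ?thesis
    by (simp add: filterlim_sequentially_Suc)
qed

section \<open>Expansion of consecutive ratios\<close>

lemma r_pos:
  assumes "\<And>n. n \<ge> 1 \<Longrightarrow> d n > 0" and "n \<ge> 1"
  shows "r d n > 0"
  using assms(1)[of n] assms(1)[of "Suc n"] assms(2) by (simp add: r_def)

text \<open>With \<open>q\<close> the ratio sequence, the squared ratio is \<open>q n * (1 + q (n + 1)) / (1 + q n)\<close>, and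
  \<open>q n * q (n + 1) - 1 = (q n - 1) * q (n + 1) + (q (n + 1) - 1)\<close>. Dividing the last difference by
  \<open>d (n + 1)\<close> in place of \<open>d n\<close> costs the factor \<open>q n\<close>; every factor on the right then has a known
  expansion.\<close>

lemma r_ratio_square:
  assumes pos: "\<And>n. n \<ge> 1 \<Longrightarrow> d n > 0" and "n \<ge> 1"
  defines "q \<equiv> \<lambda>n. d (Suc n) / d n"
  shows "((r d (Suc n) / r d n)\<^sup>2 - 1) / d n
    = ((q n - 1) / d n * q (Suc n) + (q (Suc n) - 1) / d (Suc n) * q n) / (1 + q n)"
proof -
  have p: "d n > 0" "d (Suc n) > 0" "d (Suc (Suc n)) > 0"
    using assms(2) by (auto intro: pos)
  have square: "(r d (Suc n) / r d n)\<^sup>2 = (d (Suc n) + d (Suc (Suc n))) / (d n + d (Suc n))"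
    using p assms(2) by (simp add: r_def power_divide)
  show ?thesis
    unfolding q_def square using p by (simp add: divide_simps) (simp add: algebra_simps)
qed

text \<open>The two summands of \<open>F\<close> are one sequence at consecutive indices, since
  \<open>r n / r (n + 1) - 1 = - (a - 1) / a\<close> for \<open>a = r (n + 1) / r n\<close>. This is what makes the
  constant terms cancel.\<close>

lemma F_Suc_eq:
  assumes pos: "\<And>n. n \<ge> 1 \<Longrightarrow> d n > 0" and "n \<ge> 1"
  defines "a \<equiv> \<lambda>n. r d (Suc n) / r d n"
  defines "G \<equiv> \<lambda>n. (a n - 1) / d (Suc n)"
  shows "F d (Suc n) = G n - G (Suc n) / a (Suc n)"
proof -
  have "r d n > 0" "r d (Suc n) > 0" "r d (Suc (Suc n)) > 0"
    using assms(2) by (auto intro!: r_pos[OF pos])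
  moreover have "d (Suc n) > 0" "d (Suc (Suc n)) > 0"
    by (auto intro: pos)
  ultimately show ?thesis
    unfolding F_def G_def a_def by (simp add: field_simps)
qed

theorem proposition4:
  fixes d :: "nat \<Rightarrow> real" and C :: real
  assumes pos: "\<And>n. n \<ge> 1 \<Longrightarrow> d n > 0"
    and ell2: "(\<lambda>n. (d n)\<^sup>2) summable_on {1..}"
    and not_ell1: "\<not> d abs_summable_on {1..}"
    and ratio: "(\<lambda>n. d (n + 1) / d n - (1 + C * d n)) \<in> O(\<lambda>n. (d n)\<^sup>2)"
  shows "F d \<in> O(d)"
proof -
  define q where "q = (\<lambda>n. d (Suc n) / d n)"
  define p where "p = (\<lambda>n. (q n - 1) / d n)"
  define a where "a = (\<lambda>n. r d (Suc n) / r d n)"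
  define G where "G = (\<lambda>n. (a n - 1) / d (Suc n))"
  have d0: "d \<longlonglongrightarrow> 0"
    by (rule square_summable_on_imp_tendsto_0[OF ell2])
  have ge1: "eventually (\<lambda>n::nat. n \<ge> 1) sequentially"
    by (rule eventually_ge_at_top)
  have d_pos: "eventually (\<lambda>n. d n > 0) sequentially"
    using ge1 by eventually_elim (rule pos)
  \<comment> \<open>The constants below stay unevaluated, as in \<open>1 - 1\<close> or \<open>(C * 1 + C * 1) / (1 + 1)\<close>, so that
    they mirror the expression being expanded and the rules for \<open>+\<close>, \<open>*\<close> and \<open>/\<close> match directly.\<close>
  have one: "(\<lambda>n. 1 - 1 :: real) \<in> O(d)" by simp
  have p: "(\<lambda>n. p n - C) \<in> O(d)"
  proof -
    have "(\<lambda>n. (d (n + 1) / d n - (1 + C * d n)) / d n) \<in> O(\<lambda>n. (d n)\<^sup>2 / d n)"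
      using d_pos by (intro landau_o.big.divide_right[OF _ ratio]) (auto elim: eventually_mono)
    then have "(\<lambda>n. (d (n + 1) / d n - (1 + C * d n)) / d n) \<in> O(d)"
      by (simp add: power2_eq_square)
    moreover have "eventually (\<lambda>n. (d (n + 1) / d n - (1 + C * d n)) / d n = p n - C) sequentially"
      using d_pos by eventually_elim (simp add: p_def q_def field_simps)
    ultimately show ?thesis
      by (rule bigo_eventually_eq)
  qed
  have q: "(\<lambda>n. q n - 1) \<in> O(d)"
  proof -
    have "(\<lambda>n. p n * d n) \<in> O(d)"
      by (rule tendsto_mult_bigo[OF bigo_const_imp_tendsto[OF p d0]]) simp
    moreover have "eventually (\<lambda>n. p n * d n = q n - 1) sequentially"
      using d_pos by eventually_elim (simp add: p_def)
    ultimately show ?thesis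
      by (rule bigo_eventually_eq)
  qed
  have q_lim: "q \<longlonglongrightarrow> 1"
    by (rule bigo_const_imp_tendsto[OF q d0])
  \<comment> \<open>As \<open>q n \<longlonglongrightarrow> 1\<close>, a remainder \<open>O(d n)\<close> is the same as \<open>O(d (n + 1))\<close>.\<close>
  have d_Suc: "(\<lambda>n. d (Suc n)) \<in> \<Theta>(d)"
    using d_pos by (intro bigthetaI_tendsto[where c = 1]) (use q_lim in \<open>auto simp: q_def elim: eventually_mono\<close>)
  have bigo_d_Suc: "O(\<lambda>n. d (Suc n)) = O(d)"
    by (rule landau_o.big.cong_bigtheta[OF d_Suc])
  have shift: "(\<lambda>n. f (Suc n) - c) \<in> O(d)" if "(\<lambda>n. f n - c) \<in> O(d)" for f c
    using landau_o.big.compose[OF that filterlim_Suc] by (simp only: bigo_d_Suc)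

  have a2: "(\<lambda>n. ((a n)\<^sup>2 - 1) / d n - C) \<in> O(d)"
  proof -
    have "(\<lambda>n. (p n * q (Suc n) + p (Suc n) * q n) / (1 + q n) - (C * 1 + C * 1) / (1 + 1)) \<in> O(d)"
      by (intro bigo_const_divide bigo_const_add bigo_const_mult shift[OF p] shift[OF q] p q one d0) simp
    moreover have "eventually (\<lambda>n. (p n * q (Suc n) + p (Suc n) * q n) / (1 + q n)
        - (C * 1 + C * 1) / (1 + 1) = ((a n)\<^sup>2 - 1) / d n - C) sequentially"
      using ge1 by eventually_elim (unfold a_def p_def q_def, subst r_ratio_square[OF pos], simp_all)
    ultimately show ?thesis
      by (rule bigo_eventually_eq)
  qed
  have a: "(\<lambda>n. a n - 1) \<in> O(d)"
  proof (rule bigo_square_minus_one)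
    show "eventually (\<lambda>n. a n \<ge> 0) sequentially"
      using ge1 by eventually_elim (simp add: a_def r_pos[OF pos] less_imp_le)
    have "(\<lambda>n. ((a n)\<^sup>2 - 1) / d n * d n) \<in> O(d)"
      by (rule tendsto_mult_bigo[OF bigo_const_imp_tendsto[OF a2 d0]]) simp
    moreover have "eventually (\<lambda>n. ((a n)\<^sup>2 - 1) / d n * d n = (a n)\<^sup>2 - 1) sequentially"
      using d_pos by eventually_elim simp
    ultimately show "(\<lambda>n. (a n)\<^sup>2 - 1) \<in> O(d)"
      by (rule bigo_eventually_eq)
  qed
  have G: "(\<lambda>n. G n - C / 2) \<in> O(d)"
  proof -
    have "(\<lambda>n. ((a n)\<^sup>2 - 1) / d n / (a n + 1) / q n - C / (1 + 1) / 1) \<in> O(d)"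
      by (intro bigo_const_divide bigo_const_add a a2 q one d0) simp_all
    moreover have "eventually (\<lambda>n. ((a n)\<^sup>2 - 1) / d n / (a n + 1) / q n - C / (1 + 1) / 1 = G n - C / 2) sequentially"
      using ge1
    proof eventually_elim
      case (elim n)
      have "a n > 0" "d n > 0" "d (Suc n) > 0"
        using elim by (simp_all add: a_def r_pos[OF pos] pos)
      moreover have "(a n)\<^sup>2 - 1 = (a n - 1) * (a n + 1)"
        by (simp add: power2_eq_square algebra_simps)
      ultimately show ?case
        by (simp add: G_def q_def)
    qed
    ultimately show ?thesis
      by (rule bigo_eventually_eq)
  qed

  have "(\<lambda>n. (G n - G (Suc n) / a (Suc n)) - (C / 2 - C / 2 / 1)) \<in> O(d)"
    by (intro bigo_const_diff bigo_const_divide shift[OF G] shift[OF a] G d0) simp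
  moreover have "eventually (\<lambda>n. G n - G (Suc n) / a (Suc n) - (C / 2 - C / 2 / 1) = F d (Suc n)) sequentially"
    using ge1 by eventually_elim (simp add: F_Suc_eq[OF pos] G_def a_def)
  ultimately have "(\<lambda>n. F d (Suc n)) \<in> O(d)"
    by (rule bigo_eventually_eq)
  then have "(\<lambda>n. F d (Suc n)) \<in> O(\<lambda>n. d (Suc n))"
    by (simp only: bigo_d_Suc)
  then show ?thesis
    by (rule bigo_Suc_cancel)
qed

end
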